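(* Let $p$ be an even integer and $q$ an odd integer with $3\le q<p$, let $\sigma>0$, $\varepsilon_p>0$, $\varepsilon_q\in\mathbb{R}$, with $\varepsilon_p\sigma^p(p-1)!!<1$, and consider the probability density $$p(x)=\frac{C(\vec\varepsilon)}{\sqrt{2\pi}\,\sigma}\,e^{-\frac{x^2}{2\sigma^2}}\,e^{\varepsilon_qx^q-\varepsilon_px^p},\qquad x\in\mathbb{R},\quad \vec\varepsilon=(\varepsilon_q,\varepsilon_p),$$ with $C(\vec\varepsilon)>0$ the normalizing constant. Then the first-order approximation $H^{(1)}$ of its differential entropy (defined in the context) equals the first-order entropy approximation of the density proportional to $e^{-x^2/(2\sigma^2)}e^{-\varepsilon_p x^p}$, that is, $$H^{(1)}=\log\!\Big(\sqrt{2\pi}\,\sigma\big(1-\varepsilon_p\sigma^p(p-1)!!\big)\Big)+\frac{1}{1-\varepsilon_p\sigma^p(p-1)!!}\left[\frac12+\varepsilon_p\sigma^p\Big((p-1)!!-\tfrac12(p+1)!!\Big)\right].$$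
   Context: The double factorial is $m!!=m(m-2)(m-4)\cdots1$ for odd positive $m$. Write $\mu^G_{(k)}=\int_{-\infty}^\infty\frac{1}{\sqrt{2\pi}\sigma}e^{-x^2/(2\sigma^2)}x^k\,dx$ for the Gaussian moments, so $\mu^G_{(k)}=\sigma^k(k-1)!!$ for even $k$ and $\mu^G_{(k)}=0$ for odd $k$. With $\mu_{(k)}=\int x^kp(x)\,dx$, the differential entropy $H=-\int p\log p\,dx$ of the density is $$H=\frac12\log\frac{2\pi\sigma^2}{C(\vec\varepsilon)^2}+\frac{\mu_{(2)}}{2\sigma^2}-\varepsilon_q\mu_{(q)}+\varepsilon_p\mu_{(p)}.$$ The first-order approximations of the moments and of the normalization are obtained by replacing $e^{\varepsilon_qx^q-\varepsilon_px^p}$ with its first-order expansion $1+\varepsilon_qx^q-\varepsilon_px^p$ (and, for the normalization, imposing $\mu_{(0)}=1$): $$\mu^{(1)}_{(k)}=C_1\left(\mu^G_{(k)}+\varepsilon_q\mu^G_{(k+q)}-\varepsilon_p\mu^G_{(k+p)}\right),\qquad C_1\left(1+\varepsilon_q\mu^G_{(q)}-\varepsilon_p\mu^G_{(p)}\right)=1.$$ The first-order approximation $H^{(1)}$ of the entropy is obtained by substituting $C_1$ for $C(\vec\varepsilon)$ and $\mu^{(1)}_{(k)}$ for $\mu_{(k)}$ in the formula for $H$, writing the result as $\log(\sqrt{2\pi}\sigma/C_1)+C_1\cdot B$ with $B$ a polynomial in $(\varepsilon_q,\varepsilon_p)$ (keeping $C_1$ as an unexpanded factor), and discarding from $B$ all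 terms of degree two in $(\varepsilon_q,\varepsilon_p)$. The first-order entropy approximation of the density proportional to $e^{-x^2/(2\sigma^2)}e^{-\varepsilon_px^p}$ is defined by the same procedure with $\varepsilon_q=0$. *)

theory Defs
  imports "HOL-Probability.Probability" "HOL-Computational_Algebra.Polynomial"
begin

(* Only odd arguments matter; 0!! = 1 is the usual convention. *)
fun double_fact :: "nat \<Rightarrow> nat" where
  "double_fact 0 = 1"
| "double_fact (Suc 0) = 1"
| "double_fact (Suc (Suc n)) = Suc (Suc n) * double_fact n"

definition perturbed_density ::
  "real \<Rightarrow> nat \<Rightarrow> nat \<Rightarrow> real \<Rightarrow> real \<Rightarrow> real \<Rightarrow> real \<Rightarrow> real" where
  "perturbed_density \<sigma> p q \<epsilon>q \<epsilon>p C x =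
     C / (sqrt (2 * pi) * \<sigma>) * exp (- x\<^sup>2 / (2 * \<sigma>\<^sup>2)) * exp (\<epsilon>q * x ^ q - \<epsilon>p * x ^ p)"

definition moment :: "(real \<Rightarrow> real) \<Rightarrow> nat \<Rightarrow> real" where
  "moment f k = (\<integral>x. x ^ k * f x \<partial>lborel)"

definition differential_entropy :: "(real \<Rightarrow> real) \<Rightarrow> real" where
  "differential_entropy f = - (\<integral>x. f x * ln (f x) \<partial>lborel)"

definition gauss_moment :: "real \<Rightarrow> nat \<Rightarrow> real" where
  "gauss_moment \<sigma> k = (\<integral>x. normal_density 0 \<sigma> x * x ^ k \<partial>lborel)"

(* The differential entropy of perturbed_density as an expression in the normalizing constant C
   and the moments \<mu>; see differential_entropy_perturbed_density below. *)
definition entropy_expr ::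
  "real \<Rightarrow> nat \<Rightarrow> nat \<Rightarrow> real \<Rightarrow> real \<Rightarrow> real \<Rightarrow> (nat \<Rightarrow> real) \<Rightarrow> real" where
  "entropy_expr \<sigma> p q \<epsilon>q \<epsilon>p C \<mu> =
     1 / 2 * ln (2 * pi * \<sigma>\<^sup>2 / C\<^sup>2) + \<mu> 2 / (2 * \<sigma>\<^sup>2) - \<epsilon>q * \<mu> q + \<epsilon>p * \<mu> p"

definition first_order_norm :: "real \<Rightarrow> nat \<Rightarrow> nat \<Rightarrow> real \<Rightarrow> real \<Rightarrow> real" where
  "first_order_norm \<sigma> p q \<epsilon>q \<epsilon>p =
     1 / (1 + \<epsilon>q * gauss_moment \<sigma> q - \<epsilon>p * gauss_moment \<sigma> p)"

definition first_order_moment :: "real \<Rightarrow> nat \<Rightarrow> nat \<Rightarrow> real \<Rightarrow> real \<Rightarrow> nat \<Rightarrow> real" where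
  "first_order_moment \<sigma> p q \<epsilon>q \<epsilon>p k =
     first_order_norm \<sigma> p q \<epsilon>q \<epsilon>p *
       (gauss_moment \<sigma> k + \<epsilon>q * gauss_moment \<sigma> (k + q) - \<epsilon>p * gauss_moment \<sigma> (k + p))"

(* Polynomials in the two indeterminates (\<epsilon>q, \<epsilon>p) are represented as real poly poly:
   the outer indeterminate is \<epsilon>q, the inner one \<epsilon>p. *)
definition const2 :: "real \<Rightarrow> real poly poly" where "const2 c = [:[:c:]:]"
definition Xq :: "real poly poly" where "Xq = [:0, 1:]"
definition Xp :: "real poly poly" where "Xp = [:[:0, 1:]:]"

definition eval2 :: "real poly poly \<Rightarrow> real \<Rightarrow> real \<Rightarrow> real" where
  "eval2 B a b = poly (poly B [:a:]) b"

(* Discards all terms of total degree greater than n. *)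
definition truncate2 :: "nat \<Rightarrow> real poly poly \<Rightarrow> real poly poly" where
  "truncate2 n B = (\<Sum>i\<le>n. \<Sum>j\<le>n - i. monom (monom (coeff (coeff B i) j) j) i)"

(* first_order_moment without its factor C\<^sub>1 = first_order_norm. *)
definition moment_poly :: "real \<Rightarrow> nat \<Rightarrow> nat \<Rightarrow> nat \<Rightarrow> real poly poly" where
  "moment_poly \<sigma> p q k =
     const2 (gauss_moment \<sigma> k) + Xq * const2 (gauss_moment \<sigma> (k + q))
       - Xp * const2 (gauss_moment \<sigma> (k + p))"

(* The polynomial B multiplying C\<^sub>1; see entropy_expr_first_order below. *)
definition entropy_poly :: "real \<Rightarrow> nat \<Rightarrow> nat \<Rightarrow> real poly poly" where
  "entropy_poly \<sigma> p q =
     const2 (1 / (2 * \<sigma>\<^sup>2)) * moment_poly \<sigma> p q 2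
       - Xq * moment_poly \<sigma> p q q + Xp * moment_poly \<sigma> p q p"

definition first_order_entropy :: "real \<Rightarrow> nat \<Rightarrow> nat \<Rightarrow> real \<Rightarrow> real \<Rightarrow> real" where
  "first_order_entropy \<sigma> p q \<epsilon>q \<epsilon>p =
     ln (sqrt (2 * pi) * \<sigma> / first_order_norm \<sigma> p q \<epsilon>q \<epsilon>p)
     + first_order_norm \<sigma> p q \<epsilon>q \<epsilon>p * eval2 (truncate2 1 (entropy_poly \<sigma> p q)) \<epsilon>q \<epsilon>p"

lemma half_ln_norm:
  fixes \<sigma> C :: real
  assumes "\<sigma> > 0" "C > 0"
  shows "1 / 2 * ln (2 * pi * \<sigma>\<^sup>2 / C\<^sup>2) = ln (sqrt (2 * pi) * \<sigma> / C)"
proof -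
  have "2 * pi * \<sigma>\<^sup>2 / C\<^sup>2 = (sqrt (2 * pi) * \<sigma> / C)\<^sup>2"
    by (simp add: power_divide power_mult_distrib)
  moreover have "sqrt (2 * pi) * \<sigma> / C > 0" using assms by simp
  ultimately show ?thesis by (simp add: ln_realpow)
qed

lemma entropy_expr_first_order:
  assumes "\<sigma> > 0" and "first_order_norm \<sigma> p q \<epsilon>q \<epsilon>p > 0"
  shows "entropy_expr \<sigma> p q \<epsilon>q \<epsilon>p (first_order_norm \<sigma> p q \<epsilon>q \<epsilon>p) (first_order_moment \<sigma> p q \<epsilon>q \<epsilon>p) =
     ln (sqrt (2 * pi) * \<sigma> / first_order_norm \<sigma> p q \<epsilon>q \<epsilon>p)
     + first_order_norm \<sigma> p q \<epsilon>q \<epsilon>p * eval2 (entropy_poly \<sigma> p q) \<epsilon>q \<epsilon>p"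
  unfolding entropy_expr_def half_ln_norm[OF assms]
  by (simp add: entropy_poly_def moment_poly_def first_order_moment_def eval2_def const2_def
      Xq_def Xp_def algebra_simps add_divide_distrib diff_divide_distrib)

lemma perturbation_bounded:
  fixes \<epsilon>p \<epsilon>q :: real
  assumes "even p" "q < p" "\<epsilon>p > 0"
  shows "\<exists>M. \<forall>x. \<epsilon>q * x ^ q - \<epsilon>p * x ^ p \<le> M"
proof -
  define R where "R = max 1 (\<bar>\<epsilon>q\<bar> / \<epsilon>p)"
  have "\<epsilon>q * x ^ q - \<epsilon>p * x ^ p \<le> \<bar>\<epsilon>q\<bar> * R ^ q" for x
  proof -
    have 1: "\<epsilon>q * x ^ q \<le> \<bar>\<epsilon>q\<bar> * \<bar>x\<bar> ^ q"
      by (metis abs_ge_self abs_mult power_abs)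
    have 2: "x ^ p = \<bar>x\<bar> ^ p" using assms(1) by (simp add: power_even_abs)
    show ?thesis
    proof (cases "\<bar>x\<bar> \<le> R")
      case True
      have "\<bar>\<epsilon>q\<bar> * \<bar>x\<bar> ^ q \<le> \<bar>\<epsilon>q\<bar> * R ^ q"
        using True by (intro mult_left_mono power_mono) auto
      moreover have "\<epsilon>p * x ^ p \<ge> 0" using assms 2 by simp
      ultimately show ?thesis using 1 by linarith
    next
      case False
      then have x: "\<bar>x\<bar> \<ge> 1" "\<bar>\<epsilon>q\<bar> \<le> \<epsilon>p * \<bar>x\<bar>"
        using assms(3) by (auto simp: R_def not_le pos_divide_less_eq mult.commute)
      have "\<bar>\<epsilon>q\<bar> * \<bar>x\<bar> ^ q \<le> \<epsilon>p * \<bar>x\<bar> * \<bar>x\<bar> ^ q"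
        using x by (intro mult_right_mono) auto
      also have "\<dots> = \<epsilon>p * \<bar>x\<bar> ^ Suc q" by simp
      also have "\<dots> \<le> \<epsilon>p * \<bar>x\<bar> ^ p"
        using x assms by (intro mult_left_mono power_increasing) auto
      finally have "\<epsilon>q * x ^ q - \<epsilon>p * x ^ p \<le> 0" using 1 2 by simp
      also have "0 \<le> \<bar>\<epsilon>q\<bar> * R ^ q" by (simp add: R_def)
      finally show ?thesis .
    qed
  qed
  then show ?thesis by blast
qed

lemma perturbed_density_normal:
  assumes "\<sigma> > 0"
  shows "perturbed_density \<sigma> p q \<epsilon>q \<epsilon>p C x =
    C * (normal_density 0 \<sigma> x * exp (\<epsilon>q * x ^ q - \<epsilon>p * x ^ p))"
  using assms by (simp add: perturbed_density_def normal_density_def real_sqrt_mult)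

lemma integrable_perturbed:
  assumes "even p" "q < p" "\<epsilon>p > 0" "\<sigma> > 0"
  shows "integrable lborel (\<lambda>x. x ^ k * perturbed_density \<sigma> p q \<epsilon>q \<epsilon>p C x)"
proof -
  obtain M where M: "\<And>x. \<epsilon>q * x ^ q - \<epsilon>p * x ^ p \<le> M"
    using perturbation_bounded[OF assms(1-3)] by blast
  have "integrable lborel (\<lambda>x. normal_density 0 \<sigma> x * x ^ k * exp (\<epsilon>q * x ^ q - \<epsilon>p * x ^ p))"
  proof (rule Bochner_Integration.integrable_bound)
    show "integrable lborel (\<lambda>x. exp M * (normal_density 0 \<sigma> x * \<bar>x\<bar> ^ k))"
      using integrable_normal_moment_abs[OF assms(4), of 0 k] by simp
    show "AE x in lborel. norm (normal_density 0 \<sigma> x * x ^ k * exp (\<epsilon>q * x ^ q - \<epsilon>p * x ^ p))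
        \<le> norm (exp M * (normal_density 0 \<sigma> x * \<bar>x\<bar> ^ k))"
    proof (intro AE_I2)
      fix x
      have "normal_density 0 \<sigma> x * \<bar>x\<bar> ^ k * exp (\<epsilon>q * x ^ q - \<epsilon>p * x ^ p)
          \<le> normal_density 0 \<sigma> x * \<bar>x\<bar> ^ k * exp M"
        using M[of x] by (intro mult_left_mono) auto
      then show "norm (normal_density 0 \<sigma> x * x ^ k * exp (\<epsilon>q * x ^ q - \<epsilon>p * x ^ p))
        \<le> norm (exp M * (normal_density 0 \<sigma> x * \<bar>x\<bar> ^ k))"
        by (simp add: abs_mult power_abs mult_ac)
    qed
  qed measurable
  then have "integrable lborel (\<lambda>x. C *
      (normal_density 0 \<sigma> x * x ^ k * exp (\<epsilon>q * x ^ q - \<epsilon>p * x ^ p)))"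
    by simp
  then show ?thesis
    by (simp add: perturbed_density_normal[OF assms(4)] mult_ac)
qed

lemma ex1_normalizing_constant:
  assumes "even p" "q < p" "\<epsilon>p > 0" "\<sigma> > 0"
  shows "\<exists>!C. C > 0 \<and> (\<integral>x. perturbed_density \<sigma> p q \<epsilon>q \<epsilon>p C x \<partial>lborel) = 1"
proof -
  let ?f = "perturbed_density \<sigma> p q \<epsilon>q \<epsilon>p"
  define I where "I = (\<integral>x. ?f 1 x \<partial>lborel)"
  have int: "integrable lborel (?f 1)"
    using integrable_perturbed[OF assms, of 0 \<epsilon>q 1] by simp
  have pos: "?f 1 x > 0" for x using assms by (simp add: perturbed_density_def)
  have nz: "?f 1 x \<noteq> 0" for x using pos[of x] by simp
  have "I \<noteq> 0"
  proof
    assume "I = 0"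
    then have "AE x in lborel. ?f 1 x = 0"
      using integral_nonneg_eq_0_iff_AE[OF int] pos by (simp add: I_def less_imp_le)
    then have "AE x in lborel. (x :: real) \<notin> UNIV"
      by (simp add: nz)
    then have "emeasure lborel (UNIV :: real set) = 0"
      by (subst (asm) AE_iff_measurable[OF _ refl]) auto
    then show False by simp
  qed
  moreover have "I \<ge> 0" unfolding I_def
    using pos by (intro integral_nonneg_AE AE_I2) (simp add: less_imp_le)
  ultimately have I: "I > 0" by simp
  have "(\<integral>x. ?f C x \<partial>lborel) = C * I" for C
  proof -
    have "?f C = (\<lambda>x. C * ?f 1 x)" by (auto simp: perturbed_density_def)
    then show ?thesis by (simp add: I_def)
  qed
  then show ?thesis using I
    by (intro ex1I[of _ "1 / I"]) (auto simp: field_simps)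
qed

lemma differential_entropy_perturbed_density:
  assumes "even p" "q < p" "\<epsilon>p > 0" "\<sigma> > 0" "C > 0"
    and norm: "(\<integral>x. perturbed_density \<sigma> p q \<epsilon>q \<epsilon>p C x \<partial>lborel) = 1"
  shows "differential_entropy (perturbed_density \<sigma> p q \<epsilon>q \<epsilon>p C) =
    entropy_expr \<sigma> p q \<epsilon>q \<epsilon>p C (moment (perturbed_density \<sigma> p q \<epsilon>q \<epsilon>p C))"
proof -
  let ?f = "perturbed_density \<sigma> p q \<epsilon>q \<epsilon>p C"
  let ?L = "ln (sqrt (2 * pi) * \<sigma> / C)"
  note int = integrable_perturbed[OF assms(1-4), of _ \<epsilon>q C]
  have lnf: "ln (?f x) = - ?L - x\<^sup>2 / (2 * \<sigma>\<^sup>2) + \<epsilon>q * x ^ q - \<epsilon>p * x ^ p" for x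
  proof -
    define c where "c = C / (sqrt (2 * pi) * \<sigma>)"
    have "c > 0" using assms(4,5) by (simp add: c_def)
    then have "ln (c * exp (- x\<^sup>2 / (2 * \<sigma>\<^sup>2)) * exp (\<epsilon>q * x ^ q - \<epsilon>p * x ^ p)) =
        ln c + (- x\<^sup>2 / (2 * \<sigma>\<^sup>2)) + (\<epsilon>q * x ^ q - \<epsilon>p * x ^ p)"
      by (simp add: ln_mult)
    then have "ln (?f x) = ln c + (- x\<^sup>2 / (2 * \<sigma>\<^sup>2)) + (\<epsilon>q * x ^ q - \<epsilon>p * x ^ p)"
      by (simp add: perturbed_density_def c_def)
    moreover have "ln c = - ?L"
      using assms(4,5) by (simp add: c_def ln_div)
    ultimately show ?thesis by simp
  qed
  have eq: "?f x * ln (?f x) = (- ?L) * (x ^ 0 * ?f x) - (1 / (2 * \<sigma>\<^sup>2)) * (x ^ 2 * ?f x)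
      + \<epsilon>q * (x ^ q * ?f x) - \<epsilon>p * (x ^ p * ?f x)" for x
    unfolding lnf by (simp add: algebra_simps)
  have "(\<integral>x. ?f x * ln (?f x) \<partial>lborel) = (- ?L) * moment ?f 0 - (1 / (2 * \<sigma>\<^sup>2)) * moment ?f 2
      + \<epsilon>q * moment ?f q - \<epsilon>p * moment ?f p"
    unfolding eq moment_def
    by (subst Bochner_Integration.integral_diff Bochner_Integration.integral_add
        integral_mult_right_zero
      | intro Bochner_Integration.integrable_diff Bochner_Integration.integrable_add
          integrable_mult_right int refl)+
  moreover have "moment ?f 0 = 1" using norm by (simp add: moment_def)
  ultimately show ?thesis
    unfolding entropy_expr_def half_ln_norm[OF assms(4,5)] differential_entropy_def by simp
qed

end

theory Submission
  imports Defs
begin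

text \<open>
  The Gaussian moments of odd order vanish by the symmetry of the Gaussian.
  In the normalization \<open>C\<^sub>1\<close> and in the part of \<open>B\<close> of degree at most one,
  \<open>\<epsilon>q\<close> is multiplied only by the Gaussian moments of orders \<open>q\<close> and \<open>q + 2\<close>; for odd \<open>q\<close> both
  are zero, so no first-order effect of the odd perturbation survives. The only term of \<open>B\<close> in which
  \<open>\<epsilon>q\<close> meets an even moment is \<open>\<epsilon>q\<^sup>2\<close> times the moment of order \<open>2 q\<close>; it has degree two and
  is discarded.
  What remains is expressed through the even moments of orders 2, \<open>p\<close> and \<open>p + 2\<close>,
  which are double factorials up to powers of \<open>\<sigma>\<close>.
\<close>

text \<open>
  The even Gaussian moments \<open>(2 k)! \<sigma>\<^bsup>2k\<^esup> / (2\<^sup>k k!)\<close> are quotients of factorials;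
  this identity turns them into double factorials.
\<close>

lemma fact_even_double_fact: "fact (2 * k) = 2 ^ k * fact k * double_fact (2 * k - 1)"
proof (induction k)
  case (Suc k)
  have "double_fact (2 * Suc k - 1) = (2 * k + 1) * double_fact (2 * k - 1)"
    by (cases k) auto
  then show ?case
    using Suc by (simp add: algebra_simps)
qed simp

lemma gauss_moment_odd:
  assumes "\<sigma> > 0" and "odd k"
  shows "gauss_moment \<sigma> k = 0"
proof -
  obtain j where "k = 2 * j + 1"
    using assms(2) by (elim oddE)
  then show ?thesis
    using has_bochner_integral_integral_eq[OF normal_moment_odd[OF assms(1), of 0 j]]
    by (simp add: gauss_moment_def)
qed

lemma gauss_moment_even:
  assumes "\<sigma> > 0" and "even k"
  shows "gauss_moment \<sigma> k = \<sigma> ^ k * double_fact (k - 1)"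
proof -
  obtain j where k: "k = 2 * j"
    using assms(2) by (elim evenE)
  have "gauss_moment \<sigma> k = fact (2 * j) / ((2 / \<sigma>\<^sup>2) ^ j * fact j)"
    using has_bochner_integral_integral_eq[OF normal_moment_even[OF assms(1), of 0 j]]
    by (simp add: gauss_moment_def k)
  also have "(fact (2 * j) :: real) = 2 ^ j * fact j * double_fact (2 * j - 1)"
    using arg_cong[OF fact_even_double_fact[of j], of real] by simp
  finally show ?thesis
    using assms(1) by (simp add: k power_divide power_mult)
qed

lemma eval2_truncate2_1:
  "eval2 (truncate2 1 B) a b =
    coeff (coeff B 0) 0 + b * coeff (coeff B 0) 1 + a * coeff (coeff B 1) 0"
  by (simp add: truncate2_def eval2_def poly_monom algebra_simps)

text \<open>
  The factors \<open>Xq\<close> and \<open>Xp\<close> in front of the moments of orders \<open>q\<close> and \<open>p\<close> already have degree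
  one, so only the unperturbed Gaussian part of those two moments contributes.
\<close>

lemma eval2_truncate2_entropy_poly:
  "eval2 (truncate2 1 (entropy_poly \<sigma> p q)) a b =
    1 / (2 * \<sigma>\<^sup>2) * (gauss_moment \<sigma> 2 + a * gauss_moment \<sigma> (2 + q) - b * gauss_moment \<sigma> (2 + p))
      - a * gauss_moment \<sigma> q + b * gauss_moment \<sigma> p"
  unfolding eval2_truncate2_1
  by (simp add: entropy_poly_def moment_poly_def const2_def Xq_def Xp_def algebra_simps)

lemma first_order_entropy_odd:
  fixes \<sigma> \<epsilon>q \<epsilon>p :: real
  assumes "\<sigma> > 0" and "even p" and "odd q"
  shows "first_order_entropy \<sigma> p q \<epsilon>q \<epsilon>p =
        ln (sqrt (2 * pi) * \<sigma> * (1 - \<epsilon>p * \<sigma> ^ p * double_fact (p - 1)))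
        + 1 / (1 - \<epsilon>p * \<sigma> ^ p * double_fact (p - 1)) *
          (1 / 2 + \<epsilon>p * \<sigma> ^ p * (real (double_fact (p - 1)) - 1 / 2 * double_fact (p + 1)))"
proof -
  have norm: "first_order_norm \<sigma> p q \<epsilon>q \<epsilon>p = 1 / (1 - \<epsilon>p * \<sigma> ^ p * double_fact (p - 1))"
    using assms by (simp add: first_order_norm_def gauss_moment_odd gauss_moment_even)
  have "gauss_moment \<sigma> 2 = \<sigma>\<^sup>2"
    using assms(1) gauss_moment_even[of \<sigma> 2] by simp
  moreover have "gauss_moment \<sigma> (2 + p) = \<sigma> ^ p * \<sigma>\<^sup>2 * double_fact (p + 1)"
    using assms(1,2) by (simp add: gauss_moment_even power_add power2_eq_square del: double_fact.simps)
  ultimately have "eval2 (truncate2 1 (entropy_poly \<sigma> p q)) \<epsilon>q \<epsilon>p =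
      1 / 2 + \<epsilon>p * \<sigma> ^ p * (real (double_fact (p - 1)) - 1 / 2 * double_fact (p + 1))"
    unfolding eval2_truncate2_entropy_poly
    using assms by (simp add: gauss_moment_odd gauss_moment_even field_simps power2_eq_square del: double_fact.simps)
  then show ?thesis
    by (simp add: first_order_entropy_def norm del: double_fact.simps)
qed

theorem theorem4:
  fixes p q :: nat and \<sigma> \<epsilon>p \<epsilon>q C :: real
  assumes "even p" and "odd q" and "3 \<le> q" and "q < p"
    and "\<sigma> > 0" and "\<epsilon>p > 0"
    and "\<epsilon>p * \<sigma> ^ p * double_fact (p - 1) < 1"
    and "C > 0" and "(\<integral>x. perturbed_density \<sigma> p q \<epsilon>q \<epsilon>p C x \<partial>lborel) = 1"
  shows "first_order_entropy \<sigma> p q \<epsilon>q \<epsilon>p = first_order_entropy \<sigma> p q 0 \<epsilon>p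
    \<and> first_order_entropy \<sigma> p q \<epsilon>q \<epsilon>p =
        ln (sqrt (2 * pi) * \<sigma> * (1 - \<epsilon>p * \<sigma> ^ p * double_fact (p - 1)))
        + 1 / (1 - \<epsilon>p * \<sigma> ^ p * double_fact (p - 1)) *
          (1 / 2 + \<epsilon>p * \<sigma> ^ p * (real (double_fact (p - 1)) - 1 / 2 * double_fact (p + 1)))"
  using first_order_entropy_odd[OF assms(5,1,2)] by metis

end
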